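(* For every integer $n\geq 0$, \[ \sum_{k=0}^{n}(-1)^{n-k}\binom{n}{k}P_k(x)(1+x)^{n-k}=\begin{cases} x^r\binom{2r}{r}, & \text{if } n=2r,\\ 0, & \text{if } n \text{ is odd}.\end{cases} \]
   Context: For $k\geq 0$, $P_k(x)=\sum_{j=0}^{k}\binom{k}{j}^2x^j$ denotes the type $B$ Narayana polynomial (so $P_0(x)=1$). *)

theory Defs
  imports "HOL-Computational_Algebra.Polynomial"
begin

abbreviation X :: "int poly" where
  "X \<equiv> [:0, 1:]"

definition narayana_B :: "nat \<Rightarrow> int poly" where
  "narayana_B k = (\<Sum>j=0..k. of_nat ((k choose j)\<^sup>2) * X ^ j)"

end

theory Submission
  imports Defs
begin

text \<open>
  \<open>P\<^sub>k(x)\<close> is the coefficient of \<open>t\<^sup>k\<close> in \<open>((1 + t)(1 + x t))\<^sup>k = (1 + (1 + x) t + x t\<^sup>2)\<^sup>k\<close>. Hence the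
  sum is the coefficient of \<open>t\<^sup>n\<close> in the binomial expansion of
  \<open>((1 + t)(1 + x t) - (1 + x) t)\<^sup>n = (1 + x t\<^sup>2)\<^sup>n\<close>. In bivariate polynomials, \<open>t\<close> is the outer variable.
\<close>

text \<open>The test \<open>m * j = i\<close> stays inside the sum to serve both uses: for
  \<open>m = 1\<close> at most one \<open>j\<close> survives, for \<open>m = 2\<close> the parity of
  \<open>i\<close> decides.\<close>

lemma coeff_one_plus_monom_power:
  fixes c :: "'a :: comm_ring_1"
  shows "coeff ((1 + monom c m) ^ n) i = (\<Sum>j\<le>n. if m * j = i then of_nat (n choose j) * c ^ j else 0)"
proof -
  have "(1 + monom c m) ^ n = (monom c m + 1) ^ n"
    by (simp add: add.commute)
  also have "\<dots> = (\<Sum>j\<le>n. of_nat (n choose j) * monom (c ^ j) (m * j))"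
    by (simp add: binomial_ring monom_power mult.commute)
  finally show ?thesis
    by (auto simp: coeff_sum of_nat_poly intro!: sum.cong)
qed

lemma coeff_one_plus_linear_power:
  fixes c :: "'a :: comm_ring_1"
  shows "coeff ((1 + monom c 1) ^ n) i = of_nat (n choose i) * c ^ i"
  unfolding coeff_one_plus_monom_power by (simp add: binomial_eq_0)

lemma narayana_B_eq_coeff:
  "narayana_B k = coeff (((1 + monom 1 1) * (1 + monom X 1)) ^ k) k"
proof -
  have "coeff (((1 + monom 1 1) * (1 + monom X 1)) ^ k) k
      = (\<Sum>i\<le>k. of_nat (k choose i) * (of_nat (k choose (k - i)) * X ^ (k - i)))"
    unfolding power_mult_distrib coeff_mult coeff_one_plus_linear_power by simp
  \<comment> \<open>Reversing the convolution index leaves \<open>X ^ i\<close>; binomial symmetry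
    then makes the two coefficients a square.\<close>
  also have "\<dots> = (\<Sum>i\<le>k. of_nat (k choose (k - i)) * (of_nat (k choose i) * X ^ i))"
    by (rule sum.reindex_bij_witness[of _ "\<lambda>i. k - i" "\<lambda>i. k - i"]) auto
  also have "\<dots> = narayana_B k"
    unfolding narayana_B_def atLeast0AtMost
    by (intro sum.cong) (simp_all add: binomial_symmetric[symmetric] power2_eq_square mult.assoc)
  finally show ?thesis ..
qed

theorem theorem3p1:
  fixes n :: nat
  defines "S \<equiv> (\<Sum>k=0..n. (-1) ^ (n - k) * of_nat (n choose k) * narayana_B k * (1 + X) ^ (n - k))"
  shows "(\<forall>r. n = 2 * r \<longrightarrow> S = X ^ r * of_nat ((2 * r) choose r)) \<and> (odd n \<longrightarrow> S = 0)"
proof -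
  define Q :: "int poly poly" where "Q = (1 + monom 1 1) * (1 + monom X 1)"
  have "Q + monom (- (1 + X)) 1 = 1 + monom X 2"
    by (rule poly_eqI) (auto simp: Q_def algebra_simps mult_monom coeff_1 numeral_2_eq_2)
  then have "coeff ((1 + monom X 2) ^ n) n = coeff ((Q + monom (- (1 + X)) 1) ^ n) n"
    by simp
  also have "\<dots> = (\<Sum>k\<le>n. of_nat (n choose k) * coeff (monom ((- (1 + X)) ^ (n - k)) (n - k) * Q ^ k) n)"
    \<comment> \<open>Keeping \<open>- (1 + X)\<close> intact lets \<open>power_minus\<close> split
      off the sign later.\<close>
    by (simp add: binomial_ring coeff_sum monom_power of_nat_poly mult_ac del: minus_add_distrib)
  also have "\<dots> = S"
    unfolding S_def atLeast0AtMost
  proof (intro sum.cong refl)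
    fix k assume "k \<in> {..n}"
    \<comment> \<open>The monomial shifts degrees by \<open>n - k\<close>, and
      \<open>n - (n - k) = k\<close> because \<open>k \<le> n\<close>.\<close>
    then have "coeff (monom ((- (1 + X)) ^ (n - k)) (n - k) * Q ^ k) n = (- (1 + X)) ^ (n - k) * narayana_B k"
      by (simp add: coeff_monom_mult narayana_B_eq_coeff Q_def)
    then show "of_nat (n choose k) * coeff (monom ((- (1 + X)) ^ (n - k)) (n - k) * Q ^ k) n
        = (-1) ^ (n - k) * of_nat (n choose k) * narayana_B k * (1 + X) ^ (n - k)"
      by (simp only: power_minus[of "1 + X"] mult_ac)
  qed
  finally have S: "S = (\<Sum>j\<le>n. if 2 * j = n then of_nat (n choose j) * X ^ j else 0)"
    unfolding coeff_one_plus_monom_power ..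
  show ?thesis
    \<comment> \<open>For \<open>n = 2 * r\<close> only \<open>j = r\<close> survives; for odd
      \<open>n\<close> no index does.\<close>
    unfolding S by (auto simp: mult.commute intro!: sum.neutral)
qed

end
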